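(* Let $(R,\mathfrak m)$ be a Noetherian local $F$-finite ring of characteristic $p>0$. Let $\mathfrak a$ be a proper ideal of $R$ containing an element that lies in no minimal prime of $R$, and let $J$ be an ideal of $R$ whose radical contains $\mathfrak a$. Assume that $R_P$ is $F$-pure for all prime ideals $P$ of $R$ which do not contain $\mathfrak a$. Then the $F$-threshold $c^J(\mathfrak a)$ exists, that is, $c_+^J(\mathfrak a)=c_-^J(\mathfrak a)$.
   Context: A ring $R$ of prime characteristic $p$ is $F$-finite if the Frobenius map $R\to R$, $r\mapsto r^p$, is a finite map, and $F$-pure if the Frobenius map is pure. Let $q=p^e$ denote a power of $p$ ($e\ge0$), and for an ideal $I$ let $I^{[q]}$ be the ideal generated by all $x^q$ with $x\in I$. Put $\nu^J_{\mathfrak a}(q)=\max\{r\in\mathbb N\mid \mathfrak a^r\not\subseteq J^{[q]}\}$ (with $\nu^J_{\mathfrak a}(q)=0$ if $\mathfrak a\subseteq J^{[q]}$), and $$c_+^J(\mathfrak a)=\limsup_{q\to\infty}\frac{\nu^J_{\mathfrak a}(q)}{q},\qquad c_-^J(\mathfrak a)=\liminf_{q\to\infty}\frac{\nu^J_{\mathfrak a}(q)}{q}.$$ When these agree, the common value is called the $F$-threshold $c^J(\mathfrak a)$. *)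

theory Defs
  imports
    "HOL-Algebra.Algebra"
    "HOL-Computational_Algebra.Primes"
    "HOL-Library.Extended_Real"
begin

section \<open>Local rings, minimal primes, radicals\<close>

definition local_ring :: "('a, 'x) ring_scheme \<Rightarrow> 'a set \<Rightarrow> bool" where
  "local_ring R m \<longleftrightarrow> cring R \<and> maximalideal m R \<and> (\<forall>n. maximalideal n R \<longrightarrow> n = m)"

text \<open>The additive order of \<open>\<one>\<close>, which is \<open>0\<close> when that order is infinite.\<close>

definition ring_char :: "('a, 'x) ring_scheme \<Rightarrow> nat" where
  "ring_char R = group.ord (add_monoid R) \<one>\<^bsub>R\<^esub>"

definition minimal_prime :: "('a, 'x) ring_scheme \<Rightarrow> 'a set \<Rightarrow> bool" where
  "minimal_prime R P \<longleftrightarrow> primeideal P R \<and> (\<forall>Q. primeideal Q R \<and> Q \<subseteq> P \<longrightarrow> Q = P)"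

definition radical :: "('a, 'x) ring_scheme \<Rightarrow> 'a set \<Rightarrow> 'a set" where
  "radical R J = {x \<in> carrier R. \<exists>n::nat. x [^]\<^bsub>R\<^esub> n \<in> J}"


section \<open>Localization\<close>

definition frac_rel :: "('a, 'x) ring_scheme \<Rightarrow> 'a set \<Rightarrow> (('a \<times> 'a) \<times> ('a \<times> 'a)) set" where
  "frac_rel R S = {((r, s), (r', s')). r \<in> carrier R \<and> s \<in> S \<and> r' \<in> carrier R \<and> s' \<in> S \<and>
     (\<exists>t\<in>S. t \<otimes>\<^bsub>R\<^esub> (s' \<otimes>\<^bsub>R\<^esub> r \<ominus>\<^bsub>R\<^esub> s \<otimes>\<^bsub>R\<^esub> r') = \<zero>\<^bsub>R\<^esub>)}"

definition frac :: "('a, 'x) ring_scheme \<Rightarrow> 'a set \<Rightarrow> 'a \<Rightarrow> 'a \<Rightarrow> ('a \<times> 'a) set" where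
  "frac R S r s = frac_rel R S `` {(r, s)}"

text \<open>For \<open>S\<close> multiplicatively closed the sets united in \<open>mult\<close> and \<open>add\<close> all coincide, so each
  union is a single fraction.\<close>

definition localization :: "('a, 'x) ring_scheme \<Rightarrow> 'a set \<Rightarrow> ('a \<times> 'a) set ring" where
  "localization R S =
    \<lparr>carrier = (carrier R \<times> S) // frac_rel R S,
     monoid.mult = (\<lambda>U V. \<Union>(r, s)\<in>U. \<Union>(r', s')\<in>V. frac R S (r \<otimes>\<^bsub>R\<^esub> r') (s \<otimes>\<^bsub>R\<^esub> s')),
     one = frac R S \<one>\<^bsub>R\<^esub> \<one>\<^bsub>R\<^esub>,
     ring.zero = frac R S \<zero>\<^bsub>R\<^esub> \<one>\<^bsub>R\<^esub>,
     add = (\<lambda>U V. \<Union>(r, s)\<in>U. \<Union>(r', s')\<in>V.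
              frac R S (s' \<otimes>\<^bsub>R\<^esub> r \<oplus>\<^bsub>R\<^esub> s \<otimes>\<^bsub>R\<^esub> r') (s \<otimes>\<^bsub>R\<^esub> s'))\<rparr>"

definition localization_at :: "('a, 'x) ring_scheme \<Rightarrow> 'a set \<Rightarrow> ('a \<times> 'a) set ring" where
  "localization_at R P = localization R (carrier R - P)"


section \<open>Tensor products, finite and pure homomorphisms\<close>

definition tensor_relators ::
  "('a, 'x) ring_scheme \<Rightarrow> ('a, 'm, 'y) module_scheme \<Rightarrow> ('a, 'n, 'z) module_scheme
    \<Rightarrow> ('m \<times> 'n \<Rightarrow>\<^sub>0 int) set" where
  "tensor_relators R M N =
     {frag_of (m \<oplus>\<^bsub>M\<^esub> m', n) - frag_of (m, n) - frag_of (m', n) | m m' n.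
        m \<in> carrier M \<and> m' \<in> carrier M \<and> n \<in> carrier N}
   \<union> {frag_of (m, n \<oplus>\<^bsub>N\<^esub> n') - frag_of (m, n) - frag_of (m, n') | m n n'.
        m \<in> carrier M \<and> n \<in> carrier N \<and> n' \<in> carrier N}
   \<union> {frag_of (r \<odot>\<^bsub>M\<^esub> m, n) - frag_of (m, r \<odot>\<^bsub>N\<^esub> n) | r m n.
        r \<in> carrier R \<and> m \<in> carrier M \<and> n \<in> carrier N}"

definition tensor_kernel ::
  "('a, 'x) ring_scheme \<Rightarrow> ('a, 'm, 'y) module_scheme \<Rightarrow> ('a, 'n, 'z) module_scheme
    \<Rightarrow> ('m \<times> 'n \<Rightarrow>\<^sub>0 int) set" where
  "tensor_kernel R M N =
     generate (free_Abelian_group (carrier M \<times> carrier N)) (tensor_relators R M N)"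

text \<open>The abelian group underlying \<open>M \<otimes>\<^sub>R N\<close>, written multiplicatively; injectivity of maps into
  it does not involve the scalar multiplication, which is therefore not recorded.\<close>

definition tensor_product ::
  "('a, 'x) ring_scheme \<Rightarrow> ('a, 'm, 'y) module_scheme \<Rightarrow> ('a, 'n, 'z) module_scheme
    \<Rightarrow> ('m \<times> 'n \<Rightarrow>\<^sub>0 int) set monoid" where
  "tensor_product R M N =
     free_Abelian_group (carrier M \<times> carrier N) Mod tensor_kernel R M N"

definition tensor ::
  "('a, 'x) ring_scheme \<Rightarrow> ('a, 'm, 'y) module_scheme \<Rightarrow> ('a, 'n, 'z) module_scheme
    \<Rightarrow> 'm \<Rightarrow> 'n \<Rightarrow> ('m \<times> 'n \<Rightarrow>\<^sub>0 int) set" where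
  "tensor R M N m n =
     tensor_kernel R M N #>\<^bsub>free_Abelian_group (carrier M \<times> carrier N)\<^esub> frag_of (m, n)"

definition restrict_scalars :: "('b, 'y) ring_scheme \<Rightarrow> ('a \<Rightarrow> 'b) \<Rightarrow> ('a, 'b) module" where
  "restrict_scalars S f =
    \<lparr>carrier = carrier S, monoid.mult = monoid.mult S, one = \<one>\<^bsub>S\<^esub>, ring.zero = \<zero>\<^bsub>S\<^esub>, add = add S,
     smult = (\<lambda>r s. f r \<otimes>\<^bsub>S\<^esub> s)\<rparr>"

definition finite_ring_hom ::
  "('a, 'x) ring_scheme \<Rightarrow> ('b, 'y) ring_scheme \<Rightarrow> ('a \<Rightarrow> 'b) \<Rightarrow> bool" where
  "finite_ring_hom R S f \<longleftrightarrow> f \<in> ring_hom R S \<and>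
     (\<exists>B \<subseteq> carrier S. finite B \<and>
        (\<forall>s \<in> carrier S. \<exists>c \<in> B \<rightarrow> carrier R. s = (\<Oplus>\<^bsub>S\<^esub>b\<in>B. f (c b) \<otimes>\<^bsub>S\<^esub> b)))"

text \<open>\<open>f : R \<rightarrow> S\<close> is pure if \<open>M \<rightarrow> M \<otimes>\<^sub>R S\<close>, \<open>m \<mapsto> m \<otimes> 1\<close>, is injective for every \<open>R\<close>-module \<open>M\<close>.
  A formula cannot quantify over types, so the carrier type of \<open>M\<close> has to be fixed. The type
  \<open>'a list set\<close> loses nothing: every finitely generated module is isomorphic to some \<open>R\<^sup>n/N\<close>, whose
  elements are sets of lists of length \<open>n\<close>; and an arbitrary module is the directed union of its
  finitely generated submodules, with which the tensor product commutes, so injectivity for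
  finitely generated modules gives injectivity for all modules.\<close>

definition pure_ring_hom ::
  "('a, 'x) ring_scheme \<Rightarrow> ('b, 'y) ring_scheme \<Rightarrow> ('a \<Rightarrow> 'b) \<Rightarrow> bool" where
  "pure_ring_hom R S f \<longleftrightarrow> f \<in> ring_hom R S \<and>
     (\<forall>M :: ('a, 'a list set) module. module R M \<longrightarrow>
        inj_on (\<lambda>m. tensor R M (restrict_scalars S f) m \<one>\<^bsub>S\<^esub>) (carrier M))"


section \<open>Frobenius and \<open>F\<close>-thresholds\<close>

text \<open>Throughout, \<open>p\<close> is meant to be the characteristic of \<open>R\<close>.\<close>

definition frobenius :: "nat \<Rightarrow> ('a, 'x) ring_scheme \<Rightarrow> 'a \<Rightarrow> 'a" where
  "frobenius p R r = r [^]\<^bsub>R\<^esub> p"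

definition F_finite :: "nat \<Rightarrow> ('a, 'x) ring_scheme \<Rightarrow> bool" where
  "F_finite p R \<longleftrightarrow> finite_ring_hom R R (frobenius p R)"

definition F_pure :: "nat \<Rightarrow> ('a, 'x) ring_scheme \<Rightarrow> bool" where
  "F_pure p R \<longleftrightarrow> pure_ring_hom R R (frobenius p R)"

definition frobenius_power :: "('a, 'x) ring_scheme \<Rightarrow> 'a set \<Rightarrow> nat \<Rightarrow> 'a set" where
  "frobenius_power R I q = Idl\<^bsub>R\<^esub> ((\<lambda>x. x [^]\<^bsub>R\<^esub> q) ` I)"

text \<open>The power \<open>\<aa>\<^sup>r\<close> is taken in the monoid of ideals, so \<open>\<aa>\<^sup>0 = R\<close>. The set under \<open>Max\<close> is finite
  when \<open>\<aa>\<close> is finitely generated and contained in the radical of \<open>J\<close>.\<close>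

definition nu :: "('a, 'x) ring_scheme \<Rightarrow> 'a set \<Rightarrow> 'a set \<Rightarrow> nat \<Rightarrow> nat" where
  "nu R J \<aa> q =
     (if \<aa> \<subseteq> frobenius_power R J q then 0
      else Max {r. \<not> \<aa> [^]\<^bsub>ideals_set R\<^esub> r \<subseteq> frobenius_power R J q})"

definition c_plus :: "nat \<Rightarrow> ('a, 'x) ring_scheme \<Rightarrow> 'a set \<Rightarrow> 'a set \<Rightarrow> ereal" where
  "c_plus p R J \<aa> = limsup (\<lambda>e. ereal (real (nu R J \<aa> (p ^ e)) / real (p ^ e)))"

definition c_minus :: "nat \<Rightarrow> ('a, 'x) ring_scheme \<Rightarrow> 'a set \<Rightarrow> 'a set \<Rightarrow> ereal" where
  "c_minus p R J \<aa> = liminf (\<lambda>e. ereal (real (nu R J \<aa> (p ^ e)) / real (p ^ e)))"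

end

theory Submission
  imports Defs
begin

text \<open>Let \<open>\<aa>\<close> be generated by \<open>\<mu>\<close> elements, and let \<open>q\<close>, \<open>q'\<close> be powers of \<open>p\<close>. Dividing exponents by
  \<open>q'\<close> shows that every monomial of degree at least \<open>q' (s + \<mu>)\<close> in the generators is a multiple of
  the \<open>q'\<close>-th power of an element of \<open>\<aa>\<^sup>s\<close>. For \<open>s = \<nu>(q) + 1\<close> we have \<open>\<aa>\<^sup>s \<subseteq> J\<^bsup>[q]\<^esup>\<close>, whence
  \<open>\<nu>(qq') \<le> q' (\<nu>(q) + 1 + \<mu>)\<close>, because the Frobenius map is additive. So \<open>\<nu>(qq') / (qq')\<close> exceeds
  \<open>\<nu>(q) / q\<close> by at most \<open>(1 + \<mu>) / q\<close>; let \<open>q'\<close> and then \<open>q\<close> tend to infinity.\<close>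

section \<open>Limits of almost decreasing real sequences\<close>

text \<open>Fixing \<open>m\<close> and letting \<open>n\<close> grow bounds the limsup by
  \<open>u m + \<delta> m\<close>. The liminf of these bounds over \<open>m\<close> is that of
  \<open>u\<close>, because \<open>\<delta>\<close> tends to 0.\<close>

lemma limsup_eq_liminf_of_almost_decreasing:
  fixes u :: "nat \<Rightarrow> real" and \<delta> :: "nat \<Rightarrow> real"
  assumes le: "\<And>m n. u (m + n) \<le> u m + \<delta> m" and \<delta>: "\<delta> \<longlonglongrightarrow> 0"
  shows "limsup (\<lambda>n. ereal (u n)) = liminf (\<lambda>n. ereal (u n))"
proof (rule antisym)
  have upper: "limsup (\<lambda>n. ereal (u n)) \<le> ereal (u m + \<delta> m)" for m
  proof (rule Limsup_bounded)
    show "\<forall>\<^sub>F n in sequentially. ereal (u n) \<le> ereal (u m + \<delta> m)"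
      using eventually_ge_at_top[of m]
    proof eventually_elim
      case (elim n)
      with le[of m "n - m"] show ?case by simp
    qed
  qed
  show "limsup (\<lambda>n. ereal (u n)) \<le> liminf (\<lambda>n. ereal (u n))"
  \<comment> \<open>A constant \<epsilon> takes the place of \<open>\<delta> n\<close>, since a real
    constant can be pulled out of the liminf.\<close>
  proof (rule ereal_le_epsilon2)
    fix \<epsilon> :: real assume "0 < \<epsilon>"
    then have "\<forall>\<^sub>F n in sequentially. \<delta> n < \<epsilon>"
      using \<delta> by (rule order_tendstoD(2)[rotated])
    then have "\<forall>\<^sub>F n in sequentially. limsup (\<lambda>n. ereal (u n)) \<le> ereal (u n) + ereal \<epsilon>"
    proof eventually_elim
      case (elim n)
      with upper[of n] show ?case
        by (smt (verit) ereal_less_eq(3) order_trans plus_ereal.simps(1))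
    qed
    then have "limsup (\<lambda>n. ereal (u n)) \<le> liminf (\<lambda>n. ereal (u n) + ereal \<epsilon>)"
      by (rule Liminf_bounded)
    also have "\<dots> = liminf (\<lambda>n. ereal (u n)) + ereal \<epsilon>"
      by (rule Liminf_add_ereal_right) auto
    finally show "limsup (\<lambda>n. ereal (u n)) \<le> liminf (\<lambda>n. ereal (u n)) + ereal \<epsilon>" .
  qed
qed (simp add: Liminf_le_Limsup)

context cring
begin

section \<open>Additivity of the Frobenius map\<close>

text \<open>Induction through Pascal's rule. \<open>T\<close> and \<open>V\<close> are the terms for
  \<open>n\<close> and \<open>Suc n\<close>; \<open>W\<close> has the coefficients of
  \<open>T\<close> and the exponents of \<open>V\<close>.\<close>

lemma binomial_theorem:
  assumes x: "x \<in> carrier R" and y: "y \<in> carrier R"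
  shows "(x \<oplus> y) [^] n = (\<Oplus>k\<in>{..n}. add_pow R (n choose k) (x [^] k \<otimes> y [^] (n - k)))"
proof (induction n)
  case 0
  show ?case using x y by simp
next
  case (Suc n)
  define T where "T k = add_pow R (n choose k) (x [^] k \<otimes> y [^] (n - k))" for k
  define W where "W k = add_pow R (n choose k) (x [^] k \<otimes> y [^] (Suc n - k))" for k
  define V where "V k = add_pow R (Suc n choose k) (x [^] k \<otimes> y [^] (Suc n - k))" for k
  have T: "T k \<in> carrier R" and W: "W k \<in> carrier R" and V: "V k \<in> carrier R" for k
    using x y by (simp_all add: T_def W_def V_def)
  have V0: "V 0 = W 0" by (simp add: V_def W_def)
  have VSuc: "V (Suc k) = x \<otimes> T k \<oplus> W (Suc k)" for k
  proof -
    have "x \<otimes> T k = add_pow R (n choose k) (x [^] Suc k \<otimes> y [^] (n - k))"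
      using x y by (simp add: T_def add_pow_rdistr m_ac)
    then show ?thesis
      using x y by (simp add: V_def W_def flip: add.nat_pow_mult)
  qed
  have yT: "y \<otimes> T k = W k" if "k \<le> n" for k
    using x y that by (simp add: T_def W_def add_pow_rdistr Suc_diff_le m_ac)
  \<comment> \<open>As \<open>n choose Suc n\<close> is 0, the sum of \<open>W\<close> may run to
    \<open>Suc n\<close> when it is split at 0, and to \<open>n\<close> when \<open>y\<close> is
    factored out.\<close>
  have WSuc: "W (Suc n) = \<zero>" by (simp add: W_def binomial_eq_0)
  have "(\<Oplus>k\<in>{..Suc n}. V k) = (\<Oplus>k\<in>{..n}. V (Suc k)) \<oplus> V 0"
    by (rule add.finprod_Suc2) (use V in auto)
  also have "\<dots> = (\<Oplus>k\<in>{..n}. x \<otimes> T k \<oplus> W (Suc k)) \<oplus> W 0"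
    by (simp add: VSuc V0)
  also have "\<dots> = (\<Oplus>k\<in>{..n}. x \<otimes> T k) \<oplus> ((\<Oplus>k\<in>{..n}. W (Suc k)) \<oplus> W 0)"
    using T W x by (simp add: add.finprod_multf Pi_def a_assoc)
  also have "(\<Oplus>k\<in>{..n}. W (Suc k)) \<oplus> W 0 = (\<Oplus>k\<in>{..Suc n}. W k)"
    by (rule add.finprod_Suc2[symmetric]) (use W in auto)
  also have "\<dots> = (\<Oplus>k\<in>{..n}. W k)"
    using W WSuc by (simp add: Pi_def)
  also have "\<dots> = (\<Oplus>k\<in>{..n}. y \<otimes> T k)"
    by (rule add.finprod_cong') (use yT W in auto)
  also have "(\<Oplus>k\<in>{..n}. x \<otimes> T k) \<oplus> (\<Oplus>k\<in>{..n}. y \<otimes> T k) = (x \<oplus> y) \<otimes> (\<Oplus>k\<in>{..n}. T k)"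
    using T x y by (simp add: finsum_rdistr[symmetric] l_distr Pi_def)
  also have "\<dots> = (x \<oplus> y) [^] Suc n"
    using x y Suc by (simp add: T_def m_comm)
  finally show ?case by (simp only: V_def)
qed

text \<open>The prime \<open>p\<close> divides every binomial coefficient strictly between the two
  ends, and multiples of \<open>p\<close> annihilate each \<open>z\<close> because \<open>p\<close>
  times \<open>z\<close> is \<open>p\<close> times \<one>, multiplied by \<open>z\<close>.\<close>

lemma frobenius_add:
  fixes p :: nat
  assumes p: "Factorial_Ring.prime p" and char: "add_pow R p \<one> = \<zero>"
    and x: "x \<in> carrier R" and y: "y \<in> carrier R"
  shows "(x \<oplus> y) [^] p = x [^] p \<oplus> y [^] p"
proof -
  define T where "T k = add_pow R (p choose k) (x [^] k \<otimes> y [^] (p - k))" for k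
  have T: "T k \<in> carrier R" for k using x y by (simp add: T_def)
  have killed: "add_pow R m z = \<zero>" if "p dvd m" "z \<in> carrier R" for m z
  proof -
    from that obtain k where m: "m = p * k" by blast
    have "add_pow R p z = add_pow R p \<one> \<otimes> z"
      using that by (simp add: add_pow_ldistr)
    then have "add_pow R p z = \<zero>" using that char by simp
    then show ?thesis
      using that by (simp add: m add.nat_pow_pow[symmetric])
  qed
  have middle: "T k = \<zero>" if "0 < k" "k < p" for k
    using that x y p unfolding T_def
    by (intro killed dvd_choose_prime m_closed nat_pow_closed) auto
  from p have "p > 0" by (rule prime_gt_0_nat)
  then obtain r where r: "p = Suc r" using gr0_implies_Suc by blast
  have "(x \<oplus> y) [^] p = (\<Oplus>k\<in>{..Suc r}. T k)"
    using binomial_theorem[OF x y, of p] by (simp add: T_def r)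
  also have "\<dots> = T p \<oplus> (\<Oplus>k\<in>{..r}. T k)"
    using T by (simp add: r Pi_def)
  \<comment> \<open>Below \<open>p\<close> only \<open>k = 0\<close> survives; the \<open>if\<close>
    gives the sum the shape that \<open>finprod_singleton\<close> expects.\<close>
  also have "(\<Oplus>k\<in>{..r}. T k) = (\<Oplus>k\<in>{..r}. if 0 = k then T k else \<zero>)"
    by (rule add.finprod_cong') (use T middle r in auto)
  also have "\<dots> = T 0"
    by (rule add.finprod_singleton) (use T in auto)
  finally show ?thesis using x y by (simp add: T_def)
qed

lemma frobenius_iterate_add:
  fixes p :: nat
  assumes "Factorial_Ring.prime p" "add_pow R p \<one> = \<zero>" "x \<in> carrier R" "y \<in> carrier R"
  shows "(x \<oplus> y) [^] (p ^ e) = x [^] (p ^ e) \<oplus> y [^] (p ^ e)"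
proof (induction e)
  case (Suc e)
  have "z [^] (p ^ Suc e) = (z [^] (p ^ e)) [^] p" if "z \<in> carrier R" for z
    using that by (simp add: nat_pow_pow mult.commute)
  with Suc assms show ?case by (simp add: frobenius_add)
qed (use assms in simp)

section \<open>Colon ideals and Frobenius preimages\<close>

text \<open>This is the colon ideal \<open>K : S\<close>. Because it is an ideal, a condition on
  products with all elements of a generated ideal can be checked on generators.\<close>

lemma ideal_colon:
  assumes K: "ideal K R" and S: "S \<subseteq> carrier R"
  shows "ideal {y \<in> carrier R. \<forall>z\<in>S. y \<otimes> z \<in> K} R" (is "ideal ?C R")
proof -
  interpret K: ideal K R by fact
  show ?thesis
  proof (rule idealI[OF ring_axioms])
    show "subgroup ?C (add_monoid R)"
      by (rule add.subgroupI)
        (use S in \<open>auto simp: l_minus l_distr subset_iff simp flip: a_inv_def intro!: exI[of _ \<zero>]\<close>)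
  next
    fix a x assume a: "a \<in> ?C" and x: "x \<in> carrier R"
    have "x \<otimes> a \<otimes> z \<in> K" if "z \<in> S" for z
      using a x S that K.I_l_closed[of "a \<otimes> z" x] by (auto simp: m_assoc subset_iff)
    then show "x \<otimes> a \<in> ?C" "a \<otimes> x \<in> ?C"
      using a x by (auto simp: m_comm)
  qed
qed

text \<open>An iterate of the Frobenius map is additive and multiplicative, so preimages of ideals
  are ideals. Hence statements about \<open>p ^ e\<close>-th powers can be checked on
  generators.\<close>

lemma ideal_frobenius_preimage:
  fixes p :: nat
  assumes "Factorial_Ring.prime p" "add_pow R p \<one> = \<zero>" and K: "ideal K R"
  shows "ideal {y \<in> carrier R. y [^] (p ^ e) \<in> K} R" (is "ideal ?C R")
proof -
  interpret K: ideal K R by fact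
  \<comment> \<open>Positivity puts \<zero> into the preimage; its power with exponent 0 would be
    \<one>.\<close>
  have pos: "0 < p ^ e" using prime_gt_0_nat[OF assms(1)] by simp
  have prod: "x \<otimes> a \<in> ?C" "a \<otimes> x \<in> ?C" if "a \<in> ?C" "x \<in> carrier R" for a x
    using that by (auto simp: nat_pow_distrib K.I_l_closed K.I_r_closed)
  show ?thesis
  proof (rule idealI[OF ring_axioms])
    show "subgroup ?C (add_monoid R)"
    proof (rule add.subgroupI)
      show "?C \<noteq> {}" using pos by (auto intro!: exI[of _ \<zero>] simp: nat_pow_zero)
    next
      \<comment> \<open>Negation is treated as multiplication by \<open>\<ominus> \<one>\<close>, so
        that the sign of a power need not be computed.\<close>
      fix a assume "a \<in> ?C"
      with prod(1)[of a "\<ominus> \<one>"] show "\<ominus> a \<in> ?C" by (simp add: l_minus)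
    qed (use frobenius_iterate_add[OF assms(1,2)] in auto)
  qed (use prod in auto)
qed

section \<open>Powers of ideals\<close>

lemma ideals_set_one [simp]: "\<one>\<^bsub>ideals_set R\<^esub> = carrier R"
  and ideals_set_mult [simp]: "I \<otimes>\<^bsub>ideals_set R\<^esub> J = I \<cdot> J"
  by (simp_all add: ideals_set_def)

lemma ideal_power_ideal:
  assumes "ideal \<aa> R"
  shows "ideal (\<aa> [^]\<^bsub>ideals_set R\<^esub> (n::nat)) R"
proof -
  interpret I: comm_monoid "ideals_set R" by (rule ideals_set_is_comm_monoid)
  show ?thesis
    using I.nat_pow_closed[of \<aa> n] assms by (simp add: ideals_set_def)
qed

lemma ideal_power_add:
  assumes "ideal \<aa> R"
  shows "\<aa> [^]\<^bsub>ideals_set R\<^esub> (m + n :: nat) = (\<aa> [^]\<^bsub>ideals_set R\<^esub> m) \<cdot> (\<aa> [^]\<^bsub>ideals_set R\<^esub> n)"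
proof -
  interpret I: comm_monoid "ideals_set R" by (rule ideals_set_is_comm_monoid)
  show ?thesis
    using I.nat_pow_mult[of \<aa> m n] assms by (simp add: ideals_set_def)
qed

lemma ideal_power_antimono:
  assumes \<aa>: "ideal \<aa> R" and "m \<le> n"
  shows "\<aa> [^]\<^bsub>ideals_set R\<^esub> (n::nat) \<subseteq> \<aa> [^]\<^bsub>ideals_set R\<^esub> m"
proof -
  from \<open>m \<le> n\<close> obtain k where n: "n = m + k" using le_Suc_ex by blast
  show ?thesis
    using ideal_prod_inter ideal_power_ideal[OF \<aa>]
    by (simp add: n ideal_power_add[OF \<aa>])
qed

lemma ideal_power_1:
  assumes "ideal \<aa> R"
  shows "\<aa> [^]\<^bsub>ideals_set R\<^esub> (1::nat) = \<aa>"
  using ideal_prod_commute[OF oneideal assms] ideal_prod_one[OF assms]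
  by simp

lemma nat_pow_in_ideal_power:
  assumes "ideal \<aa> R" "x \<in> \<aa>"
  shows "x [^] n \<in> \<aa> [^]\<^bsub>ideals_set R\<^esub> (n::nat)"
  by (induction n) (use assms in \<open>auto intro: ideal_prod.prod\<close>)

section \<open>Monomials in the generators\<close>

text \<open>Exponents are indexed by the elements of \<open>A\<close> themselves, so the degree of
  the monomial is \<open>sum c A\<close>.\<close>

definition monom_at :: "'a set \<Rightarrow> ('a \<Rightarrow> nat) \<Rightarrow> 'a"
  where "monom_at A c = (\<Otimes>x\<in>A. x [^] c x)"

lemma monom_at_closed: "A \<subseteq> carrier R \<Longrightarrow> monom_at A c \<in> carrier R"
  unfolding monom_at_def by (rule finprod_closed) auto

lemma monom_at_remove:
  assumes "finite A" "A \<subseteq> carrier R" "x \<in> A"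
  shows "monom_at A c = x [^] c x \<otimes> monom_at (A - {x}) c"
proof -
  have "monom_at (insert x (A - {x})) c = x [^] c x \<otimes> monom_at (A - {x}) c"
    unfolding monom_at_def using assms by (subst finprod_insert) auto
  then show ?thesis using assms by (simp add: insert_absorb)
qed

lemma monom_at_add:
  assumes "A \<subseteq> carrier R"
  shows "monom_at A (\<lambda>x. c x + d x) = monom_at A c \<otimes> monom_at A d"
proof -
  have "monom_at A (\<lambda>x. c x + d x) = (\<Otimes>x\<in>A. x [^] c x \<otimes> x [^] d x)"
    unfolding monom_at_def
    by (rule finprod_cong') (use assms in \<open>auto simp: nat_pow_mult\<close>)
  also have "\<dots> = monom_at A c \<otimes> monom_at A d"
    unfolding monom_at_def by (rule finprod_multf) (use assms in auto)
  finally show ?thesis .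
qed

lemma monom_at_mult:
  assumes "A \<subseteq> carrier R"
  shows "monom_at A (\<lambda>x. m * c x) = monom_at A c [^] (m::nat)"
proof (induction m)
  case 0
  show ?case by (simp add: monom_at_def)
next
  case (Suc m)
  then show ?case
    using monom_at_add[OF assms, of "\<lambda>x. m * c x" c] by (simp add: add.commute)
qed

lemma monom_at_in_ideal_power:
  assumes \<aa>: "ideal \<aa> R" and "finite A" "A \<subseteq> \<aa>"
  shows "monom_at A c \<in> \<aa> [^]\<^bsub>ideals_set R\<^esub> sum c A"
  using assms(2,3)
proof (induction A)
  case empty
  show ?case by (simp add: monom_at_def)
next
  case (insert x A)
  then have "insert x A \<subseteq> carrier R" using ideal.Icarr[OF \<aa>] by blast
  with insert have "monom_at (insert x A) c = x [^] c x \<otimes> monom_at A c"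
    using monom_at_remove[of "insert x A" x c] by simp
  then show ?case
    using insert nat_pow_in_ideal_power[OF \<aa>]
    by (simp add: ideal_power_add[OF \<aa>] ideal_prod.prod)
qed

section \<open>Testing the containment of ideal powers on monomials\<close>

text \<open>Induction on \<open>n\<close> with \<open>K\<close> varying: the power of exponent
  \<open>Suc n\<close> lies in \<open>K\<close> once the power of exponent \<open>n\<close> lies in
  \<open>K : \<aa>\<close>. A monomial \<open>y\<close> of degree \<open>n\<close> lies in
  \<open>K : \<aa>\<close> because \<open>K : y\<close> contains every generator \<open>x\<close>,
  the product of \<open>x\<close> and \<open>y\<close> being a monomial of degree
  \<open>Suc n\<close>.\<close>

lemma ideal_power_subset_if_monoms:
  assumes A: "finite A" "A \<subseteq> carrier R" and \<aa>: "\<aa> = Idl A" and K: "ideal K R"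
    and mon: "\<And>c. sum c A = n \<Longrightarrow> monom_at A c \<in> K"
  shows "\<aa> [^]\<^bsub>ideals_set R\<^esub> (n::nat) \<subseteq> K"
  using K mon
proof (induction n arbitrary: K)
  case 0
  have "\<one> \<in> K"
    \<comment> \<open>The monomial with all exponents 0 is \<one>, so \<open>K\<close> is the whole
      ring, as is the power with exponent 0.\<close>
    using "0.prems"(2)[of "\<lambda>_. 0"] by (simp add: monom_at_def)
  then show ?case
    using ideal.one_imp_carrier[OF "0.prems"(1)] by simp
next
  case (Suc n)
  interpret K: ideal K R by fact
  have ideal_\<aa>: "ideal \<aa> R" using A genideal_ideal by (simp add: \<aa>)
  have \<aa>_carr: "\<aa> \<subseteq> carrier R" using ideal.Icarr[OF ideal_\<aa>] by blast
  let ?C = "{y \<in> carrier R. \<forall>z\<in>\<aa>. y \<otimes> z \<in> K}"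
  have "\<aa> [^]\<^bsub>ideals_set R\<^esub> n \<subseteq> ?C"
  proof (rule Suc.IH)
    show "ideal ?C R" using K.ideal_axioms \<aa>_carr by (rule ideal_colon)
  next
    fix c assume c: "sum c A = n"
    let ?y = "monom_at A c"
    have y: "?y \<in> carrier R" using A by (simp add: monom_at_closed)
    let ?D = "{z \<in> carrier R. \<forall>w\<in>{?y}. z \<otimes> w \<in> K}"
    have "A \<subseteq> ?D"
    proof
      fix x assume x: "x \<in> A"
      \<comment> \<open>The exponent vector of the single generator \<open>x\<close>.\<close>
      let ?d = "\<lambda>z. if z = x then 1 else (0::nat)"
      have "sum (\<lambda>z. c z + ?d z) A = Suc n"
        using c x A by (simp add: sum.distrib)
      then have "monom_at A (\<lambda>z. c z + ?d z) \<in> K" by (rule Suc.prems(2))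
      moreover have "monom_at A ?d = x"
      proof -
        have "monom_at (A - {x}) ?d = \<one>"
          unfolding monom_at_def by (rule finprod_one_eqI) auto
        then show ?thesis using x A monom_at_remove[of A x ?d] by auto
      qed
      ultimately show "x \<in> ?D"
        using x A y monom_at_add[OF A(2), of c ?d] by (auto simp: m_comm)
    qed
    moreover have "ideal ?D R" using K.ideal_axioms y by (intro ideal_colon) auto
    ultimately have "\<aa> \<subseteq> ?D" unfolding \<aa> by (intro genideal_minimal)
    then show "?y \<in> ?C" using y \<aa>_carr by (auto simp: m_comm)
  qed
  then have prod: "i \<otimes> j \<in> K" if "i \<in> \<aa> [^]\<^bsub>ideals_set R\<^esub> n" "j \<in> \<aa>" for i j
    using that by blast
  have "z \<in> K" if "z \<in> (\<aa> [^]\<^bsub>ideals_set R\<^esub> n) \<cdot> \<aa>" for z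
    using that by induction (use prod K.a_closed in blast)+
  then show ?case by auto
qed

text \<open>Rounding all exponents of a monomial down to multiples of \<open>m\<close> costs at most
  \<open>m * card A\<close> in degree. What remains is the \<open>m\<close>-th power of a monomial
  of degree at least \<open>s\<close>.\<close>

lemma ideal_power_subset_if_powers:
  assumes A: "finite A" "A \<subseteq> carrier R" and \<aa>: "\<aa> = Idl A" and K: "ideal K R"
    and pow: "\<And>y. y \<in> \<aa> [^]\<^bsub>ideals_set R\<^esub> (s::nat) \<Longrightarrow> y [^] (m::nat) \<in> K"
    and "0 < m" and N: "m * (s + card A) \<le> N"
  shows "\<aa> [^]\<^bsub>ideals_set R\<^esub> (N::nat) \<subseteq> K"
proof (rule ideal_power_subset_if_monoms[OF A \<aa> K])
  fix c assume c: "sum c A = N"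
  have ideal_\<aa>: "ideal \<aa> R" using A genideal_ideal by (simp add: \<aa>)
  have "A \<subseteq> \<aa>" using A genideal_self by (simp add: \<aa>)
  have "N \<le> (\<Sum>x\<in>A. m * (c x div m) + m)"
    unfolding c[symmetric]
  proof (rule sum_mono)
    fix x
    have "c x mod m \<le> m" using \<open>0 < m\<close> by (simp add: less_imp_le)
    then show "c x \<le> m * (c x div m) + m"
      by (metis add_left_mono mult_div_mod_eq)
  qed
  also have "\<dots> = m * ((\<Sum>x\<in>A. c x div m) + card A)"
    by (simp add: sum.distrib sum_distrib_left distrib_left mult.commute)
  finally have "m * (s + card A) \<le> m * ((\<Sum>x\<in>A. c x div m) + card A)"
    using N by linarith
  then have "s \<le> (\<Sum>x\<in>A. c x div m)" using \<open>0 < m\<close> by simp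
  then have "monom_at A (\<lambda>x. c x div m) \<in> \<aa> [^]\<^bsub>ideals_set R\<^esub> s"
    using ideal_power_antimono[OF ideal_\<aa>] monom_at_in_ideal_power[OF ideal_\<aa> A(1) \<open>A \<subseteq> \<aa>\<close>]
    by blast
  then have "monom_at A (\<lambda>x. c x div m) [^] m \<in> K" by (rule pow)
  \<comment> \<open>The monomial of the remainders is a cofactor, absorbed by the ideal
    \<open>K\<close>.\<close>
  moreover have "monom_at A c = monom_at A (\<lambda>x. m * (c x div m) + c x mod m)"
    by simp
  ultimately show "monom_at A c \<in> K"
    using A by (simp only: monom_at_add[OF A(2)] monom_at_mult[OF A(2)])
      (intro ideal.I_r_closed[OF K] monom_at_closed)
qed

text \<open>Pigeonhole: in this degree some exponent exceeds \<open>m\<close>. The summand 1 also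
  covers empty \<open>A\<close>, where no monomial has positive degree.\<close>

lemma ideal_power_subset_if_gen_powers:
  assumes A: "finite A" "A \<subseteq> carrier R" and \<aa>: "\<aa> = Idl A" and K: "ideal K R"
    and pow: "\<And>x. x \<in> A \<Longrightarrow> x [^] (m::nat) \<in> K"
  shows "\<aa> [^]\<^bsub>ideals_set R\<^esub> (m * card A + 1) \<subseteq> K"
proof (rule ideal_power_subset_if_monoms[OF A \<aa> K])
  fix c assume c: "sum c A = m * card A + 1"
  have "\<exists>x\<in>A. m < c x"
  proof (rule ccontr)
    assume "\<not> (\<exists>x\<in>A. m < c x)"
    then have "sum c A \<le> (\<Sum>x\<in>A. m)" by (intro sum_mono) (auto simp: not_less)
    with c show False by (simp add: mult.commute)
  qed
  then obtain x where x: "x \<in> A" "m < c x" by blast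
  then have "x [^] c x = x [^] m \<otimes> x [^] (c x - m)"
    using A by (auto simp: nat_pow_mult)
  then have "x [^] c x \<in> K"
    using x A pow ideal.I_r_closed[OF K] by auto
  then show "monom_at A c \<in> K"
    using A x by (simp add: monom_at_remove) (auto intro!: ideal.I_r_closed[OF K] monom_at_closed)
qed

section \<open>Frobenius powers of ideals\<close>

lemma ideal_frobenius_power:
  "J \<subseteq> carrier R \<Longrightarrow> ideal (frobenius_power R J q) R"
  unfolding frobenius_power_def by (rule genideal_ideal) auto

lemma pow_in_frobenius_power:
  "J \<subseteq> carrier R \<Longrightarrow> y \<in> J \<Longrightarrow> y [^] q \<in> frobenius_power R J q"
  unfolding frobenius_power_def using genideal_self[of "(\<lambda>x. x [^] q) ` J"] by auto

text \<open>On the generators \<open>x [^] q\<close> this is multiplication of exponents; the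
  Frobenius preimage of the right-hand ideal is an ideal, so the generators suffice.\<close>

lemma frobenius_power_pow:
  fixes p :: nat
  assumes "Factorial_Ring.prime p" "add_pow R p \<one> = \<zero>" and J: "J \<subseteq> carrier R"
    and y: "y \<in> frobenius_power R J q"
  shows "y [^] (p ^ e) \<in> frobenius_power R J (q * p ^ e)"
proof -
  let ?C = "{y \<in> carrier R. y [^] (p ^ e) \<in> frobenius_power R J (q * p ^ e)}"
  have "frobenius_power R J q \<subseteq> ?C"
    unfolding frobenius_power_def[of R J q]
  proof (rule genideal_minimal)
    show "ideal ?C R"
      using assms by (intro ideal_frobenius_preimage ideal_frobenius_power)
    show "(\<lambda>x. x [^] q) ` J \<subseteq> ?C"
      using J pow_in_frobenius_power[OF J] by (auto simp: nat_pow_pow subset_iff)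
  qed
  with y show ?thesis by blast
qed

text \<open>A common power of the finitely many generators lies in \<open>J\<close>, and its
  \<open>q\<close>-th power in the Frobenius power; the pigeonhole criterion then applies. This
  makes the set in the definition of \<open>nu\<close> finite.\<close>

lemma exists_ideal_power_subset_frobenius_power:
  assumes A: "finite A" "A \<subseteq> carrier R" and \<aa>: "\<aa> = Idl A" and J: "ideal J R"
    and rad: "A \<subseteq> radical R J"
  shows "\<exists>N::nat. \<aa> [^]\<^bsub>ideals_set R\<^esub> N \<subseteq> frobenius_power R J q"
proof -
  have Jcarr: "J \<subseteq> carrier R" using ideal.Icarr[OF J] by blast
  from rad have "\<forall>x\<in>A. \<exists>n::nat. x [^] n \<in> J" by (auto simp: radical_def)
  then obtain f :: "'a \<Rightarrow> nat" where f: "\<And>x. x \<in> A \<Longrightarrow> x [^] f x \<in> J" by metis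
  \<comment> \<open>\<open>sum f A\<close> serves as an exponent that works for all generators at
    once.\<close>
  have "x [^] (sum f A * q) \<in> frobenius_power R J q" if x: "x \<in> A" for x
  proof -
    have "f x \<le> sum f A" using A x by (intro member_le_sum) auto
    then have "x [^] sum f A = x [^] f x \<otimes> x [^] (sum f A - f x)"
      using A x by (auto simp: nat_pow_mult)
    then have "x [^] sum f A \<in> J"
      using f[OF x] A x by (auto intro!: ideal.I_r_closed[OF J])
    then have "(x [^] sum f A) [^] q \<in> frobenius_power R J q"
      by (rule pow_in_frobenius_power[OF Jcarr])
    then show ?thesis using x A by (auto simp: nat_pow_pow)
  qed
  then show ?thesis
    using ideal_power_subset_if_gen_powers[OF A \<aa> ideal_frobenius_power[OF Jcarr]] by blast
qed

section \<open>Bounds for \<open>nu\<close>\<close>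

text \<open>Powers of \<open>\<aa>\<close> decrease, so every exponent in the set under
  \<open>Max\<close> is below \<open>N\<close>. The set is therefore finite, and the successor of
  its maximum is outside it.\<close>

lemma nu_le:
  assumes \<aa>: "ideal \<aa> R"
    and N: "\<aa> [^]\<^bsub>ideals_set R\<^esub> (N::nat) \<subseteq> frobenius_power R J q"
  shows "nu R J \<aa> q \<le> N"
    and "\<aa> [^]\<^bsub>ideals_set R\<^esub> (nu R J \<aa> q + 1) \<subseteq> frobenius_power R J q"
proof -
  let ?S = "{r::nat. \<not> \<aa> [^]\<^bsub>ideals_set R\<^esub> r \<subseteq> frobenius_power R J q}"
  have S: "?S \<subseteq> {..<N}"
  proof
    fix r assume "r \<in> ?S"
    then show "r \<in> {..<N}"
      using ideal_power_antimono[OF \<aa>, of N r] N by (cases "r < N") auto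
  qed
  then have fin: "finite ?S" by (rule finite_subset) simp
  have one: "\<aa> [^]\<^bsub>ideals_set R\<^esub> (1::nat) = \<aa>" by (rule ideal_power_1[OF \<aa>])
  show "nu R J \<aa> q \<le> N"
  proof (cases "\<aa> \<subseteq> frobenius_power R J q")
    case False
    then have "1 \<in> ?S" using one by simp
    then have "Max ?S \<in> ?S" using fin by (intro Max_in) blast+
    with S show ?thesis using False by (auto simp: nu_def)
  qed (simp add: nu_def)
  show "\<aa> [^]\<^bsub>ideals_set R\<^esub> (nu R J \<aa> q + 1) \<subseteq> frobenius_power R J q"
  proof (cases "\<aa> \<subseteq> frobenius_power R J q")
    \<comment> \<open>Here \<open>nu\<close> has its default value 0, and the first power of
      \<open>\<aa>\<close> is \<open>\<aa>\<close> itself.\<close>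
    case True
    then show ?thesis using one by (simp add: nu_def)
  next
    case False
    have "Max ?S + 1 \<notin> ?S" using Max_ge[OF fin, of "Max ?S + 1"] by auto
    then show ?thesis using False by (simp add: nu_def)
  qed
qed

lemma nu_mult_le:
  fixes p :: nat
  assumes p: "Factorial_Ring.prime p" "add_pow R p \<one> = \<zero>"
    and A: "finite A" "A \<subseteq> carrier R" and \<aa>: "\<aa> = Idl A" and J: "ideal J R"
    and rad: "A \<subseteq> radical R J"
  shows "nu R J \<aa> (q * p ^ e) \<le> p ^ e * (nu R J \<aa> q + 1 + card A)"
proof -
  have ideal_\<aa>: "ideal \<aa> R" using A genideal_ideal by (simp add: \<aa>)
  have Jcarr: "J \<subseteq> carrier R" using ideal.Icarr[OF J] by blast
  obtain N :: nat where "\<aa> [^]\<^bsub>ideals_set R\<^esub> N \<subseteq> frobenius_power R J q"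
    using exists_ideal_power_subset_frobenius_power[OF A \<aa> J rad] by blast
  then have "\<aa> [^]\<^bsub>ideals_set R\<^esub> (nu R J \<aa> q + 1) \<subseteq> frobenius_power R J q"
    by (rule nu_le(2)[OF ideal_\<aa>])
  then have "y [^] (p ^ e) \<in> frobenius_power R J (q * p ^ e)"
    if "y \<in> \<aa> [^]\<^bsub>ideals_set R\<^esub> (nu R J \<aa> q + 1)" for y
    using that frobenius_power_pow[OF p Jcarr] by blast
  \<comment> \<open>The criterion on \<open>m\<close>-th powers is used with
    \<open>m = p ^ e\<close> and \<open>s = nu R J \<aa> q + 1\<close>, an exponent whose power of
    \<open>\<aa>\<close> lies in the Frobenius power.\<close>
  then have "\<aa> [^]\<^bsub>ideals_set R\<^esub> (p ^ e * (nu R J \<aa> q + 1 + card A))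
      \<subseteq> frobenius_power R J (q * p ^ e)"
    using prime_gt_0_nat[OF p(1)]
    by (intro ideal_power_subset_if_powers[OF A \<aa> ideal_frobenius_power[OF Jcarr],
          of "nu R J \<aa> q + 1" "p ^ e"]) auto
  then show ?thesis by (rule nu_le(1)[OF ideal_\<aa>])
qed

end

section \<open>Existence of the F-threshold\<close>

theorem theorem1p6:
  fixes R :: "('a, 'x) ring_scheme" and \<mm> \<aa> J :: "'a set" and p :: nat
  assumes "noetherian_ring R" and "local_ring R \<mm>"
    and "Factorial_Ring.prime p" and "ring_char R = p"
    and "F_finite p R"
    and "ideal \<aa> R" and "\<aa> \<noteq> carrier R"
    and "\<exists>x \<in> \<aa>. \<forall>P. minimal_prime R P \<longrightarrow> x \<notin> P"
    and "ideal J R" and "\<aa> \<subseteq> radical R J"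
    and "\<And>P. primeideal P R \<Longrightarrow> \<not> \<aa> \<subseteq> P \<Longrightarrow> F_pure p (localization_at R P)"
  shows "c_plus p R J \<aa> = c_minus p R J \<aa>"
proof -
  interpret cring R using assms(2) by (simp add: local_ring_def)
  \<comment> \<open>The characteristic is defined as the additive order of \<one>.\<close>
  have char: "add_pow R p \<one>\<^bsub>R\<^esub> = \<zero>\<^bsub>R\<^esub>"
    using add.pow_ord_eq_1[OF one_closed] assms(4) unfolding ring_char_def by metis
  obtain A where A: "finite A" "A \<subseteq> carrier R" "\<aa> = Idl\<^bsub>R\<^esub> A"
    using noetherian_ring.finetely_gen[OF assms(1,6)] by blast
  have "A \<subseteq> radical R J"
    using A genideal_self assms(10) by blast
  note bound = nu_mult_le[OF assms(3) char A assms(9) this]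
  define u where "u e = real (nu R J \<aa> (p ^ e)) / real (p ^ e)" for e
  have p: "1 < p" using assms(3) by (rule prime_gt_1_nat)
  \<comment> \<open>The error term is the excess \<open>p ^ n * (1 + card A)\<close> divided by
    \<open>p ^ (m + n)\<close>; the factor \<open>p ^ n\<close> cancels, so it depends on
    \<open>m\<close> alone.\<close>
  have "u (m + n) \<le> u m + real (1 + card A) / real (p ^ m)" for m n
  proof -
    have "real (nu R J \<aa> (p ^ (m + n))) \<le> real (p ^ n * (nu R J \<aa> (p ^ m) + 1 + card A))"
      using bound[of "p ^ m" n] by (simp only: power_add of_nat_le_iff)
    then have "u (m + n) \<le> real (p ^ n * (nu R J \<aa> (p ^ m) + 1 + card A)) / real (p ^ (m + n))"
      unfolding u_def by (rule divide_right_mono) simp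
    also have "\<dots> = u m + real (1 + card A) / real (p ^ m)"
      using p by (simp add: u_def power_add field_simps)
    finally show ?thesis .
  qed
  moreover have "(\<lambda>m. real (1 + card A) / real (p ^ m)) \<longlonglongrightarrow> 0"
  proof -
    have "(\<lambda>m. real (1 + card A) * inverse (real p ^ m)) \<longlonglongrightarrow> real (1 + card A) * 0"
      using p by (intro tendsto_mult tendsto_const LIMSEQ_inverse_realpow_zero) auto
    then show ?thesis by (simp add: divide_inverse)
  qed
  ultimately show ?thesis
    unfolding c_plus_def c_minus_def u_def[symmetric]
    by (rule limsup_eq_liminf_of_almost_decreasing)
qed

end
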